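(* Let $P_1,\dots,P_m:\mathbb{R}^n\to\mathbb{R}$ be polynomials with real coefficients, let $c=(c_1,\dots,c_m)\in\mathbb{R}^m$, and let $f(\mathbf{x})=\sum_{i=1}^m\bigl(c_i-P_i(\mathbf{x})\bigr)^2$ be the residual sum of squares of the system $P_i(\mathbf{x})=c_i$, $i=1,\dots,m$. Let $\mathbf{x}^{(k)}\in\mathbb{R}^n$ be any point and $\mathbf{d}\in\mathbb{R}^n$ any search direction, and let $\mathbf{x}_{pg}^{(k+1)}$ be the point obtained by the penetrating gradient algorithm from the current point $\mathbf{x}^{(k)}$ with search direction $\mathbf{d}$. Then $\mathbf{x}_{pg}^{(k+1)}$ is a global minimizer of $f$ along the line of search direction, i.e. $f(\mathbf{x}_{pg}^{(k+1)})\le f(\mathbf{x})$ for every $\mathbf{x}\in\{\mathbf{x}^{(k)}+\alpha\mathbf{d}:\alpha\in\mathbb{R}\}$.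
   Context: Penetrating gradient algorithm (for the polynomial system $P_i(\mathbf{x})=c_i$, $i=1,\dots,m$, with residual sum of squares $f$): given a current point $\mathbf{x}$ and a search direction $\mathbf{d}$, form the univariate polynomial $\phi(\alpha)=f(\mathbf{x}+\alpha\mathbf{d})=\sum_{i=1}^m\bigl(c_i-P_i(\mathbf{x}+\alpha\mathbf{d})\bigr)^2$ in the real variable $\alpha$. Compute the roots of the equation $\phi'(\alpha)=0$, equivalently of $\sum_{i=1}^m\bigl(c_i-P_i(\mathbf{x}+\alpha\mathbf{d})\bigr)\frac{d}{d\alpha}P_i(\mathbf{x}+\alpha\mathbf{d})=0$. Among the real roots, select one, $\alpha^*$, with the lowest value of $\phi$ (so $\phi'(\alpha^* )=0$ and $\phi(\alpha^* )\le\phi(\alpha)$ for every real $\alpha$ with $\phi'(\alpha)=0$). The point obtained by the algorithm is $\mathbf{x}+\alpha^*\mathbf{d}$. *)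

theory Defs
  imports "HOL-Analysis.Analysis"
begin

definition rss :: "('m::finite \<Rightarrow> real ^ 'n \<Rightarrow> real) \<Rightarrow> real ^ 'm \<Rightarrow> real ^ 'n \<Rightarrow> real" where
  "rss P c x = (\<Sum>i\<in>UNIV. (c $ i - P i x)\<^sup>2)"

definition line_rss ::
    "('m::finite \<Rightarrow> real ^ 'n \<Rightarrow> real) \<Rightarrow> real ^ 'm \<Rightarrow> real ^ 'n \<Rightarrow> real ^ 'n \<Rightarrow> real \<Rightarrow> real" where
  "line_rss P c x d \<alpha> = rss P c (x + \<alpha> *\<^sub>R d)"

text \<open>
  The real roots of the derivative are expressed with \<^const>\<open>has_field_derivative\<close> rather than
  \<^const>\<open>deriv\<close>, whose value is unspecified where the function is not differentiable.
\<close>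

definition stationary_steps ::
    "('m::finite \<Rightarrow> real ^ 'n \<Rightarrow> real) \<Rightarrow> real ^ 'm \<Rightarrow> real ^ 'n \<Rightarrow> real ^ 'n \<Rightarrow> real set" where
  "stationary_steps P c x d = {\<alpha>. (line_rss P c x d has_real_derivative 0) (at \<alpha>)}"

text \<open>
  The step is not unique when several stationary steps attain the lowest value, so the algorithm is
  a relation between its input and its possible outputs.
\<close>

definition penetrating_gradient_point ::
    "('m::finite \<Rightarrow> real ^ 'n \<Rightarrow> real) \<Rightarrow> real ^ 'm \<Rightarrow> real ^ 'n \<Rightarrow> real ^ 'n \<Rightarrow> real ^ 'n \<Rightarrow> bool" where
  "penetrating_gradient_point P c x d y \<longleftrightarrow>
     (\<exists>\<alpha>\<^sub>0 \<in> stationary_steps P c x d.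
        (\<forall>\<alpha> \<in> stationary_steps P c x d. line_rss P c x d \<alpha>\<^sub>0 \<le> line_rss P c x d \<alpha>) \<and>
        y = x + \<alpha>\<^sub>0 *\<^sub>R d)"

end

theory Submission
  imports Defs
begin

text \<open>
  Along the line, \<open>f\<close> is a nonnegative univariate polynomial, so it is constant or tends to
  infinity at both ends; either way it attains its infimum. The minimizer is a root of the
  derivative, so the root with the lowest value is a global minimizer as well.
\<close>

lemma nonneg_real_polynomial_function_attains_inf:
  fixes g :: "real \<Rightarrow> real"
  assumes poly: "real_polynomial_function g" and nonneg: "\<And>t. 0 \<le> g t"
  obtains s where "\<And>t. g s \<le> g t"
proof -
  obtain a n where g: "g = (\<lambda>t. \<Sum>i\<le>n. a i * t ^ i)"
    using poly by (auto simp: real_polynomial_function_iff_sum)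
  show thesis
  \<comment> \<open>The split is on the coefficients of positive degree rather than on
    \<open>n\<close>, because \<open>n\<close> only bounds the degree and \<open>a n\<close> may
    vanish.\<close>
  proof (cases "\<exists>k. k \<noteq> 0 \<and> k \<le> n \<and> a k \<noteq> 0")
    case True
    \<comment> \<open>A nonconstant polynomial eventually exceeds any bound in norm. The bound
      \<open>g 0\<close> is chosen because 0 lies in every ball used below, so a minimum over the
      ball also beats the values outside it.\<close>
    then have "eventually (\<lambda>t. g 0 \<le> norm (g t)) at_infinity"
      unfolding g by (rule polyfun_extremal)
    then obtain b where b: "\<And>t. b \<le> \<bar>t\<bar> \<Longrightarrow> g 0 \<le> g t"
      using nonneg by (auto simp: eventually_at_infinity)
    \<comment> \<open>The threshold \<open>b\<close> may be negative; the radius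
      \<open>\<bar>b\<bar>\<close> keeps the ball nonempty.\<close>
    have "continuous_on (cball 0 \<bar>b\<bar>) g"
      by (intro continuous_at_imp_continuous_on ballI continuous_real_polymonial_function poly)
    then obtain s where s: "\<And>t. t \<in> cball 0 \<bar>b\<bar> \<Longrightarrow> g s \<le> g t"
      using continuous_attains_inf[of "cball 0 \<bar>b\<bar>" g] by fastforce
    have "g s \<le> g t" for t
    proof (cases "t \<in> cball 0 \<bar>b\<bar>")
      case False
      then have "g 0 \<le> g t" by (intro b) auto
      with s[of 0] show ?thesis by simp
    qed (rule s)
    then show thesis by (rule that)
  next
    case False
    \<comment> \<open>Terms of positive degree have coefficient 0; the term of degree 0 agrees at
      \<open>t\<close> and 0 since \<open>0 ^ 0 = 1\<close>.\<close>
    then have "g t = g 0" for t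
      unfolding g by (intro sum.cong refl) (metis atMost_iff mult_zero_left power_0)
    then show thesis by (metis order_refl that)
  qed
qed

text \<open>The line is an affine map of the step, and polynomials are closed under composition,
  differences, squares and finite sums.\<close>

lemma real_polynomial_function_line_rss:
  assumes "\<And>i. real_polynomial_function (P i)"
  shows "real_polynomial_function (line_rss P c x d)"
proof -
  have "polynomial_function (\<lambda>\<alpha>. x + \<alpha> *\<^sub>R d)"
    by (intro polynomial_function_add polynomial_function_const polynomial_function_bounded_linear
        bounded_linear_scaleR_left)
  then have "real_polynomial_function (\<lambda>\<alpha>. P i (x + \<alpha> *\<^sub>R d))" for i
    using real_polynomial_function_compose[OF _ assms] by (simp add: o_def)
  then show ?thesis
    unfolding line_rss_def rss_def
    by (intro real_polynomial_function_sum real_polynomial_function_power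
        real_polynomial_function_diff) (auto intro: real_polynomial_function.intros)
qed

theorem proposition1:
  fixes P :: "'m::finite \<Rightarrow> real ^ 'n \<Rightarrow> real"
    and c :: "real ^ 'm"
    and x d x_pg :: "real ^ 'n"
  assumes "\<And>i. real_polynomial_function (P i)"
    and "penetrating_gradient_point P c x d x_pg"
  shows "\<forall>y \<in> {x + \<alpha> *\<^sub>R d | \<alpha>. \<alpha> \<in> (UNIV :: real set)}. rss P c x_pg \<le> rss P c y"
proof -
  let ?\<phi> = "line_rss P c x d"
  have poly: "real_polynomial_function ?\<phi>"
    using assms(1) by (rule real_polynomial_function_line_rss)
  moreover have "0 \<le> ?\<phi> \<alpha>" for \<alpha>
    by (simp add: line_rss_def rss_def sum_nonneg)
  ultimately obtain \<beta> where \<beta>: "\<And>\<alpha>. ?\<phi> \<beta> \<le> ?\<phi> \<alpha>"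
    by (rule nonneg_real_polynomial_function_attains_inf) blast
  obtain D where D: "(?\<phi> has_real_derivative D) (at \<beta>)"
    using differentiable_at_real_polynomial_function[OF poly] real_differentiable_def by blast
  \<comment> \<open>Since \<open>\<beta>\<close> is a global minimizer, any positive radius serves
    as its neighbourhood; 1 is arbitrary.\<close>
  then have "D = 0"
    by (rule DERIV_local_min[where d = 1]) (use \<beta> in auto)
  with D have "\<beta> \<in> stationary_steps P c x d"
    by (simp add: stationary_steps_def)
  with assms(2) obtain \<alpha>\<^sub>0 where "?\<phi> \<alpha>\<^sub>0 \<le> ?\<phi> \<beta>" and "x_pg = x + \<alpha>\<^sub>0 *\<^sub>R d"
    unfolding penetrating_gradient_point_def by blast
  with \<beta> have "rss P c x_pg \<le> ?\<phi> \<alpha>" for \<alpha>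
    by (metis line_rss_def order_trans)
  then show ?thesis
    by (auto simp: line_rss_def)
qed

end
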